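(* Suppose that $B=\{b_1,b_2,\dots\}$ is a set of positive integers that is good, meaning that for any $b\in B$ there are infinitely many elements of $B$ coprime to $b$. Then there exists a sequence $a_1,a_2,\dots$ which contains all elements of the set $B$, and each element only finitely many times, such that the two-dimensional Rademacher walk $S_n=\sum_{i=1}^n a_i\xi_i$ is recurrent.
   Context: Let $\mathbf{e}_1=(1,0)$, $\mathbf{e}_2=(0,1)$. A random vector $\xi$ has the two-dimensional Rademacher distribution if it takes each of the values $\mathbf{e}_1,\mathbf{e}_2,-\mathbf{e}_1,-\mathbf{e}_2$ with probability $1/4$. Given a deterministic sequence $a_1,a_2,\dots$ of positive real numbers, the two-dimensional Rademacher walk is $S_n=a_1\xi_1+\dots+a_n\xi_n$, where $\xi_1,\xi_2,\dots$ are i.i.d. two-dimensional Rademacher random variables. The walk $S_n$ is called recurrent if, for each $z\in\mathbb{Z}^2$, almost surely $S_n=z$ for infinitely many $n$. *)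

theory Defs
  imports "HOL-Probability.Probability"
begin

definition rademacher2 :: "(real \<times> real) measure" where
  "rademacher2 =
     distr (measure_pmf (pmf_of_set {(1, 0), (0, 1), (-1, 0), (0, -1)})) borel (\<lambda>x. x)"

definition iid_rademacher2 :: "'w measure \<Rightarrow> (nat \<Rightarrow> 'w \<Rightarrow> real \<times> real) \<Rightarrow> bool" where
  "iid_rademacher2 M \<xi> \<longleftrightarrow>
     prob_space M \<and>
     prob_space.indep_vars M (\<lambda>_. borel) \<xi> UNIV \<and>
     (\<forall>i. distr M borel (\<xi> i) = rademacher2)"

text \<open>Indices start at 0, so \<open>a i\<close> and \<open>\<xi> i\<close> are the coefficient and the random vector
  with number \<open>i + 1\<close> in the usual numbering.\<close>

definition rademacher2_walk ::
    "(nat \<Rightarrow> real) \<Rightarrow> (nat \<Rightarrow> 'w \<Rightarrow> real \<times> real) \<Rightarrow> nat \<Rightarrow> 'w \<Rightarrow> real \<times> real" where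
  "rademacher2_walk a \<xi> n \<omega> = (\<Sum>i<n. a i *\<^sub>R \<xi> i \<omega>)"

definition recurrent :: "'w measure \<Rightarrow> (nat \<Rightarrow> 'w \<Rightarrow> real \<times> real) \<Rightarrow> bool" where
  "recurrent M S \<longleftrightarrow>
     (\<forall>x y :: int. AE \<omega> in M. infinite {n. S n \<omega> = (of_int x, of_int y)})"

text \<open>Recurrence depends only on the joint law of the random vectors. To quantify over coefficient
  sequences independently of a sample space, recurrence of a coefficient sequence is defined on the
  canonical product space; by \<open>recurrent_iff_rademacher2_recurrent\<close> any other space with an
  i.i.d. sequence gives the same notion.\<close>

definition rademacher2_space :: "(nat \<Rightarrow> real \<times> real) measure" where
  "rademacher2_space = PiM UNIV (\<lambda>_. rademacher2)"

definition rademacher2_recurrent :: "(nat \<Rightarrow> real) \<Rightarrow> bool" where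
  "rademacher2_recurrent a \<longleftrightarrow>
     recurrent rademacher2_space (rademacher2_walk a (\<lambda>i \<omega>. \<omega> i))"

definition good :: "nat set \<Rightarrow> bool" where
  "good B \<longleftrightarrow> (\<forall>b\<in>B. infinite {c \<in> B. coprime b c})"

lemma rademacher2_prob:
  assumes "v \<in> {(1, 0), (0, 1), (-1, 0), (0, -1)}"
  shows "measure rademacher2 {v} = 1 / 4"
proof -
  have "measure rademacher2 {v} =
      measure (measure_pmf (pmf_of_set {(1, 0), (0, 1), (-1, 0), (0, -1)})) {v}"
    by (simp add: rademacher2_def measure_distr)
  also have "\<dots> = pmf (pmf_of_set {(1, 0), (0, 1), (-1, 0), (0, -1)}) v"
    by (simp add: pmf.rep_eq)
  also have "\<dots> = 1 / 4"
    using assms by (subst pmf_of_set) (auto simp: indicator_def)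
  finally show ?thesis .
qed

lemma sets_rademacher2 [simp, measurable_cong]: "sets rademacher2 = sets borel"
  by (simp add: rademacher2_def)

lemma space_rademacher2 [simp]: "space rademacher2 = UNIV"
  by (simp add: rademacher2_def)

lemma prob_space_rademacher2: "prob_space rademacher2"
  unfolding rademacher2_def by (intro measure_pmf.prob_space_distr) simp

lemma iid_rademacher2_canonical: "iid_rademacher2 rademacher2_space (\<lambda>i \<omega>. \<omega> i)"
proof -
  interpret P: prob_space rademacher2_space
    unfolding rademacher2_space_def by (intro prob_space_PiM prob_space_rademacher2)
  have sets_eq: "sets rademacher2_space = sets (PiM UNIV (\<lambda>_. borel))"
    unfolding rademacher2_space_def by (intro sets_PiM_cong) simp_all
  have meas: "(\<lambda>\<omega>. \<omega> i) \<in> borel_measurable rademacher2_space" for i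
    by (subst measurable_cong_sets[OF sets_eq refl]) simp
  have law: "distr rademacher2_space borel (\<lambda>\<omega>. \<omega> i) = rademacher2" for i
  proof -
    have "distr rademacher2_space borel (\<lambda>\<omega>. \<omega> i) =
        distr rademacher2_space rademacher2 (\<lambda>\<omega>. \<omega> i)"
      by (rule distr_cong) simp_all
    then show ?thesis
      unfolding rademacher2_space_def
      using distr_PiM_component[of UNIV "\<lambda>_. rademacher2" i] prob_space_rademacher2 by simp
  qed
  have joint: "distr rademacher2_space (PiM UNIV (\<lambda>_. borel)) (\<lambda>\<omega>. \<lambda>i\<in>UNIV. \<omega> i) =
      distr rademacher2_space rademacher2_space (\<lambda>\<omega>. \<omega>)"
    by (rule distr_cong) (simp_all add: sets_eq restrict_def)
  have "P.indep_vars (\<lambda>_. borel) (\<lambda>i \<omega>. \<omega> i) UNIV"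
    by (subst P.indep_vars_iff_distr_eq_PiM)
      (simp_all add: meas law joint, simp add: rademacher2_space_def)
  then show ?thesis
    by (simp add: iid_rademacher2_def law P.prob_space_axioms)
qed

lemma recurrent_iff_rademacher2_recurrent:
  assumes "iid_rademacher2 M \<xi>"
  shows "recurrent M (rademacher2_walk a \<xi>) \<longleftrightarrow> rademacher2_recurrent a"
proof -
  interpret M: prob_space M
    using assms by (simp add: iid_rademacher2_def)
  have indep: "M.indep_vars (\<lambda>_. borel) \<xi> UNIV" and law: "\<And>i. distr M borel (\<xi> i) = rademacher2"
    using assms by (auto simp: iid_rademacher2_def)
  have meas: "\<xi> i \<in> borel_measurable M" for i
    using indep by (auto simp: M.indep_vars_def)
  have joint: "rademacher2_space = distr M (PiM UNIV (\<lambda>_. borel)) (\<lambda>\<omega> i. \<xi> i \<omega>)"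
    using indep by (subst (asm) M.indep_vars_iff_distr_eq_PiM)
      (simp_all add: meas law rademacher2_space_def restrict_def)
  have f: "(\<lambda>\<omega> i. \<xi> i \<omega>) \<in> measurable M (PiM UNIV (\<lambda>_. borel))"
    by (rule measurable_PiM_single') (auto simp: meas)
  have "(AE \<omega> in rademacher2_space. infinite {n. rademacher2_walk a (\<lambda>i \<omega>. \<omega> i) n \<omega> = z}) \<longleftrightarrow>
      (AE \<omega> in M. infinite {n. rademacher2_walk a \<xi> n \<omega> = z})" for z
  proof -
    have "{\<omega> \<in> space (PiM UNIV (\<lambda>_. borel)). infinite {n. (\<Sum>i<n. a i *\<^sub>R \<omega> i) = z}}
        \<in> sets (PiM UNIV (\<lambda>_. borel))"
      unfolding infinite_nat_iff_unbounded mem_Collect_eq by measurable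
    then show ?thesis
      unfolding joint rademacher2_walk_def by (subst AE_distr_iff[OF f]) simp_all
  qed
  then show ?thesis
    by (simp add: rademacher2_recurrent_def recurrent_def)
qed

end

theory Submission
  imports Defs
begin

text \<open>The simple random walk on the plane lattice is recurrent: \<open>ln (\<bar>x\<bar>\<^sup>2 - 1 / 2)\<close> is superharmonic
  away from the origin and tends to infinity, so the maximum principle forces the probability of
  never hitting the origin to vanish. If \<open>b\<close> and \<open>c\<close> are coprime, at most \<open>2 b\<close> steps of
  length \<open>c\<close> can bring the walk into the residue class of a target \<open>z\<close> modulo \<open>b\<close>, with
  a probability bounded below uniformly in the starting point; a long run of \<open>b\<close>-steps then hits
  \<open>z\<close> by recurrence. Repeating this gives, for every bounded set of starting points, a finite
  word in \<open>b\<close> and \<open>c\<close> along which \<open>z\<close> is hit with probability at least \<open>1 / 2\<close>.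
  The sequence concatenates such words: the \<open>k\<close>-th word uses the \<open>k\<close>-th element of \<open>B\<close> and
  a coprime element that is at least \<open>k\<close>, so each element is used finitely often, while the targets
  run through all lattice points infinitely often.\<close>

section \<open>Finite walks and their probability of missing a point\<close>

text \<open>\<open>miss z w p\<close> is the probability that the walk started at \<open>p\<close>, with successive step lengths
  given by the list \<open>w\<close>, never visits \<open>z\<close> (the starting point and the end point count as
  visited).\<close>

fun miss :: "int \<times> int \<Rightarrow> nat list \<Rightarrow> int \<times> int \<Rightarrow> real" where
  "miss z [] p = (if p = z then 0 else 1)"
| "miss z (c # w) (x, y) =
    (if (x, y) = z then 0
     else (miss z w (x + int c, y) + miss z w (x - int c, y)
         + miss z w (x, y + int c) + miss z w (x, y - int c)) / 4)"

fun ends :: "nat list \<Rightarrow> int \<times> int \<Rightarrow> (int \<times> int) set" where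
  "ends [] p = {p}"
| "ends (c # w) (x, y) = ends w (x + int c, y) \<union> ends w (x - int c, y)
     \<union> ends w (x, y + int c) \<union> ends w (x, y - int c)"

definition square :: "nat \<Rightarrow> (int \<times> int) set" where
  "square R = {- int R..int R} \<times> {- int R..int R}"

lemma finite_square: "finite (square R)"
  by (simp add: square_def)

lemma miss_bounds: "0 \<le> miss z w p \<and> miss z w p \<le> 1"
proof (induction w arbitrary: p)
  case (Cons c w)
  obtain x y where p: "p = (x, y)" by (cases p)
  show ?case
    using Cons[of "(x + int c, y)"] Cons[of "(x - int c, y)"]
      Cons[of "(x, y + int c)"] Cons[of "(x, y - int c)"]
    by (simp add: p)
qed simp

lemmas miss_nonneg = miss_bounds[THEN conjunct1] and miss_le_1 = miss_bounds[THEN conjunct2]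

lemma miss_self [simp]: "miss z w z = 0"
  by (cases w; cases z) auto

text \<open>Markov property at the end of \<open>u\<close>: a path that has missed \<open>z\<close>
  so far continues from a point of \<open>ends u p\<close>, where the bound \<open>\<beta>\<close>
  applies.\<close>

lemma miss_append_le:
  assumes "\<And>q. q \<in> ends u p \<Longrightarrow> miss z v q \<le> \<beta>" "0 \<le> \<beta>"
  shows "miss z (u @ v) p \<le> \<beta> * miss z u p"
  using assms(1)
proof (induction u arbitrary: p)
  case Nil
  then show ?case by (cases "p = z") auto
next
  case (Cons c u)
  obtain x y where p: "p = (x, y)" by (cases p)
  have *: "miss z (u @ v) q \<le> \<beta> * miss z u q"
    if "q \<in> {(x + int c, y), (x - int c, y), (x, y + int c), (x, y - int c)}" for q
    using that by (intro Cons) (auto simp: p)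
  show ?case
    using *[of "(x + int c, y)"] *[of "(x - int c, y)"]
      *[of "(x, y + int c)"] *[of "(x, y - int c)"]
    by (auto simp: p distrib_left)
qed

lemma miss_append_le_left: "miss z (u @ v) p \<le> miss z u p"
  using miss_append_le[of u p z v 1] miss_le_1 by simp

lemma ends_square:
  assumes "p \<in> square R" "q \<in> ends w p"
  shows "q \<in> square (R + sum_list w)"
  using assms
proof (induction w arbitrary: p R)
  case (Cons c w)
  obtain x y where p: "p = (x, y)" by (cases p)
  have "r \<in> square (R + c)"
    if "r \<in> {(x + int c, y), (x - int c, y), (x, y + int c), (x, y - int c)}" for r
    using that Cons.prems(1) by (auto simp: p square_def)
  then show ?case
    using Cons.IH[of _ "R + c"] Cons.prems(2) by (auto simp: p add.assoc)
qed simp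

lemma square_mono: "R \<le> R' \<Longrightarrow> square R \<subseteq> square R'"
  by (auto simp: square_def)

lemma ends_replicate_dvd:
  assumes "q \<in> ends (replicate N b) p"
  shows "int b dvd fst q - fst p \<and> int b dvd snd q - snd p"
  using assms
proof (induction N arbitrary: p)
  case (Suc N)
  obtain x y where p: "p = (x, y)" by (cases p)
  have "q \<in> ends (replicate N b) r \<Longrightarrow> int b dvd fst q - fst r \<and> int b dvd snd q - snd r" for r
    using Suc.IH by blast
  moreover have "int b dvd u - (v + int b) \<longleftrightarrow> int b dvd u - v"
      "int b dvd u - (v - int b) \<longleftrightarrow> int b dvd u - v" for u v
    using dvd_add_right_iff[of "int b" "int b" "u - v"]
      dvd_diff_right_iff[of "int b" "int b" "u - v"]
    by (smt (verit) dvd_add_triv_left_iff dvd_diff_commute dvd_add_triv_right_iff)+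
  ultimately show ?case using Suc.prems by (fastforce simp: p)
qed simp

text \<open>Translation by \<open>(u, v)\<close> and division by \<open>b\<close> turn the walk with
  steps \<open>b\<close> into the simple random walk; as \<open>b\<close> is positive, visits to
  \<open>(u, v)\<close> correspond to visits to the origin.\<close>

lemma miss_replicate_scale:
  assumes "0 < b"
  shows "miss (u, v) (replicate N b) (u + int b * x, v + int b * y)
       = miss (0, 0) (replicate N 1) (x, y)"
proof (induction N arbitrary: x y)
  case 0
  then show ?case using assms by auto
next
  case (Suc N)
  show ?case
    using Suc[of "x + 1" y] Suc[of "x - 1" y] Suc[of x "y + 1"] Suc[of x "y - 1"] assms
    by (simp add: algebra_simps)
qed

subsection \<open>Recurrence of the simple random walk\<close>

text \<open>A Lyapunov function for the simple random walk. The shift by \<open>1 / 2\<close> of the squared norm is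
  exactly what makes the logarithm superharmonic on the diagonals, and \<open>63\<close> is the least factor for
  which this persists at the neighbours of the origin, where the function is given the value 0.\<close>

definition lyap :: "int \<times> int \<Rightarrow> real" where
  "lyap p = (if p = (0, 0) then 0 else ln (63 * (2 * ((real_of_int (fst p))\<^sup>2 + (real_of_int (snd p))\<^sup>2) - 1)))"

lemma sum_squares_ge_1: "(x, y) \<noteq> (0, 0) \<Longrightarrow> 1 \<le> (real_of_int x)\<^sup>2 + (real_of_int y)\<^sup>2"
proof -
  assume "(x, y) \<noteq> (0, 0)"
  then have "0 < x\<^sup>2 + y\<^sup>2" by (simp add: sum_power2_gt_zero_iff)
  then have "1 \<le> x\<^sup>2 + y\<^sup>2" by simp
  then have "real_of_int 1 \<le> real_of_int (x\<^sup>2 + y\<^sup>2)" by linarith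
  then show ?thesis by simp
qed

text \<open>At the four neighbours of the point the expression \<open>t\<close> becomes t + 2 + 4x,
  t + 2 - 4x, t + 2 + 4y and t + 2 - 4y, so the left side is the product of these values.\<close>

lemma lyap_poly_aux:
  fixes x y :: real
  defines "t \<equiv> 2 * (x\<^sup>2 + y\<^sup>2) - 1"
  shows "((t + 2)\<^sup>2 - 16 * x\<^sup>2) * ((t + 2)\<^sup>2 - 16 * y\<^sup>2) \<le> t ^ 4"
proof -
  have "t ^ 4 - ((t + 2)\<^sup>2 - 16 * x\<^sup>2) * ((t + 2)\<^sup>2 - 16 * y\<^sup>2) = 64 * (x\<^sup>2 - y\<^sup>2)\<^sup>2"
    unfolding t_def by algebra
  then show ?thesis using zero_le_power2[of "x\<^sup>2 - y\<^sup>2"] by linarith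
qed

text \<open>After exponentiation, the product of the values at the neighbours has to be at most a
  fourth power. If the origin is not a neighbour, this is \<open>lyap_poly_aux\<close> times
  63^4.\<close>

lemma lyap_superharmonic:
  assumes "(x, y) \<noteq> (0, 0)"
  shows "lyap (x + 1, y) + lyap (x - 1, y) + lyap (x, y + 1) + lyap (x, y - 1) \<le> 4 * lyap (x, y)"
proof (cases "\<bar>x\<bar> + \<bar>y\<bar> = 1")
  case True
  then have "(x, y) \<in> {(1, 0), (-1, 0), (0, 1), (0, -1)}" by auto
  \<comment> \<open>The neighbours of a unit vector are the origin, one point of squared norm 4 and
    two of squared norm 2, with values 0, ln (63 * 7) and ln (63 * 3). Equality holds because 7 * 3
    * 3 = 63.\<close>
  moreover have "ln 441 + 2 * ln 189 = 4 * ln (63::real)"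
  proof -
    have "ln 441 + 2 * ln 189 = ln (441 * 189 ^ 2 :: real)"
      by (subst ln_mult_pos; (subst ln_realpow)?; simp only: of_nat_numeral zero_less_power zero_less_numeral)
    also have "\<dots> = ln (63 ^ 4)" by simp
    also have "\<dots> = 4 * ln (63::real)" by (subst ln_realpow) auto
    finally show ?thesis .
  qed
  ultimately show ?thesis by (auto simp: lyap_def)
next
  case False
  define w where "w p = 63 * (2 * ((real_of_int (fst p))\<^sup>2 + (real_of_int (snd p))\<^sup>2) - 1)" for p
  have nz: "(x + 1, y) \<noteq> (0, 0)" "(x - 1, y) \<noteq> (0, 0)" "(x, y + 1) \<noteq> (0, 0)" "(x, y - 1) \<noteq> (0, 0)"
    using False by auto
  have eq: "lyap p = ln (w p)" and pos: "0 < w p" if "p \<noteq> (0, 0)" for p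
    using that sum_squares_ge_1[of "fst p" "snd p"] by (auto simp: lyap_def w_def prod_eq_iff)
  note posn = nz[THEN pos] assms[THEN pos] and eqn = nz[THEN eq] assms[THEN eq]
  have "w (x + 1, y) * w (x - 1, y) * w (x, y + 1) * w (x, y - 1) \<le> w (x, y) ^ 4"
    using mult_left_mono[OF lyap_poly_aux[of "real_of_int x" "real_of_int y"], of "63 ^ 4"]
    by (simp add: w_def algebra_simps power2_eq_square power4_eq_xxxx)
  moreover have "0 < w (x + 1, y) * w (x - 1, y) * w (x, y + 1) * w (x, y - 1)" "0 < w (x, y) ^ 4"
    by (intro mult_pos_pos zero_less_power posn)+
  ultimately have "ln (w (x + 1, y) * w (x - 1, y) * w (x, y + 1) * w (x, y - 1)) \<le> ln (w (x, y) ^ 4)"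
    by (subst ln_le_cancel_iff) assumption+
  moreover have "ln (w (x + 1, y) * w (x - 1, y) * w (x, y + 1) * w (x, y - 1))
      = ln (w (x + 1, y)) + ln (w (x - 1, y)) + ln (w (x, y + 1)) + ln (w (x, y - 1))"
    by (simp add: ln_mult_pos posn)
  moreover have "ln (w (x, y) ^ 4) = 4 * ln (w (x, y))"
    by (subst ln_realpow) (auto intro: posn)
  ultimately show ?thesis unfolding eqn by linarith
qed

lemma finite_lyap_less: "finite {p. lyap p < C}"
proof -
  define R where "R = nat \<lceil>exp C\<rceil>"
  have "p \<in> square R" if "lyap p < C" for p
  proof (cases "p = (0, 0)")
    case False
    obtain x y where p: "p = (x, y)" by (cases p)
    define s where "s = (real_of_int x)\<^sup>2 + (real_of_int y)\<^sup>2"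
    have s: "1 \<le> s" using False sum_squares_ge_1 by (simp add: p s_def)
    have "ln (63 * (2 * s - 1)) < C" using that False unfolding lyap_def p s_def by (simp only: fst_conv snd_conv if_False)
    then have "63 * (2 * s - 1) < exp C"
      using s by (smt (verit) exp_less_mono exp_ln zero_less_mult_iff)
    moreover have "s \<le> 63 * (2 * s - 1)" using s by simp
    ultimately have "s \<le> exp C" by linarith
    then have s_le: "s \<le> real_of_int (int R)" by (simp add: R_def; linarith)
    have "real_of_int (x\<^sup>2 + y\<^sup>2) \<le> real_of_int (int R)"
      using s_le by (simp add: s_def)
    then have "x\<^sup>2 + y\<^sup>2 \<le> int R" by linarith
    moreover have "\<bar>u\<bar> \<le> u\<^sup>2" for u :: int
      using self_le_power[of "\<bar>u\<bar>" 2] by (cases "u = 0") auto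
    ultimately have "\<bar>x\<bar> \<le> int R" "\<bar>y\<bar> \<le> int R"
      by (smt (verit) zero_le_power2)+
    then show ?thesis by (auto simp: p square_def)
  qed (simp add: square_def)
  then show ?thesis by (intro finite_subset[OF _ finite_square[of R]]) auto
qed

text \<open>Off the origin \<open>g - e * lyap\<close> is subharmonic, and it is positive at
  finitely many points only, so a positive maximum would be attained. At the rightmost maximum
  point, the mean value inequality makes the right neighbour a maximum point too.\<close>

lemma maximum_principle:
  fixes g :: "int \<times> int \<Rightarrow> real"
  assumes g0: "g (0, 0) = 0" and le1: "\<And>p. g p \<le> 1"
    and harm: "\<And>x y. (x, y) \<noteq> (0, 0) \<Longrightarrow>
      g (x, y) \<le> (g (x + 1, y) + g (x - 1, y) + g (x, y + 1) + g (x, y - 1)) / 4"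
  shows "g p \<le> 0"
proof -
  have "g p \<le> e * lyap p" if e: "0 < e" for e p
  proof (rule ccontr)
    define f where "f q = g q - e * lyap q" for q
    define A where "A = {q. 0 < f q}"
    assume "\<not> g p \<le> e * lyap p"
    then have "p \<in> A" by (simp add: A_def f_def)
    then have ne: "A \<noteq> {}" by blast
    have "A \<subseteq> {q. lyap q < 1 / e}"
      using le1 e by (auto simp: A_def f_def field_simps intro: less_le_trans)
    then have fin: "finite A" using finite_lyap_less finite_subset by blast
    define m where "m = Max (f ` A)"
    define A' where "A' = {q \<in> A. f q = m}"
    have le_m: "f q \<le> m" and m_pos: "0 < m" for q
    proof -
      have *: "f q \<le> m" if "q \<in> A" for q using fin that by (auto simp: m_def)
      show "0 < m" using ne * unfolding A_def by fastforce
      then show "f q \<le> m" using *[of q] by (cases "q \<in> A") (auto simp: A_def)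
    qed
    have "m \<in> f ` A" unfolding m_def using fin ne by (intro Max_in) auto
    then have ne': "A' \<noteq> {}" by (auto simp: A'_def)
    have fin': "finite (fst ` A')" using fin by (simp add: A'_def)
    obtain x y where xy: "(x, y) \<in> A'" and x: "x = Max (fst ` A')"
      using Max_in[OF fin'] ne' by force
    have nz: "(x, y) \<noteq> (0, 0)"
      using xy m_pos g0 by (auto simp: A'_def A_def f_def lyap_def)
    have "4 * m = 4 * f (x, y)" using xy by (simp add: A'_def)
    also have "\<dots> \<le> f (x + 1, y) + f (x - 1, y) + f (x, y + 1) + f (x, y - 1)"
      using harm[OF nz] mult_left_mono[OF lyap_superharmonic[OF nz], of e] e
      by (simp add: f_def algebra_simps)
    finally have "m \<le> f (x + 1, y)"
      using le_m[of "(x - 1, y)"] le_m[of "(x, y + 1)"] le_m[of "(x, y - 1)"] by linarith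
    then have "(x + 1, y) \<in> A'"
      using le_m[of "(x + 1, y)"] m_pos by (auto simp: A'_def A_def)
    then have "x + 1 \<le> x" unfolding x using fin' by (intro Max_ge) (force simp flip: x)+
    then show False by simp
  qed
  note le = this
  show ?thesis
  proof (rule ccontr)
    assume "\<not> g p \<le> 0"
    then have pos: "0 < g p" "0 < lyap p" using le[of 1 p] by auto
    \<comment> \<open>The case \<open>e = 1\<close> has shown \<open>lyap p\<close> to be positive;
      this smaller \<open>e\<close> replaces a limit.\<close>
    then have "g p \<le> g p / (2 * lyap p) * lyap p" by (intro le) simp
    also have "\<dots> = g p / 2" using pos by simp
    finally show False using pos by simp
  qed
qed

text \<open>The probabilities decrease in \<open>N\<close>. By the recursion on the first step their
  limit is harmonic off the origin and vanishes there, so the maximum principle applies.\<close>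

lemma miss_replicate_1_tendsto_0: "(\<lambda>N. miss (0, 0) (replicate N 1) p) \<longlonglongrightarrow> 0"
proof -
  define s where "s p N = miss (0, 0) (replicate N 1) p" for p N
  have dec: "decseq (s p)" for p
  proof (rule decseq_SucI)
    fix N
    show "s p (Suc N) \<le> s p N"
      using miss_append_le_left[of "(0,0)" "replicate N 1" "[1]" p]
      by (simp add: s_def replicate_append_same)
  qed
  define g where "g p = lim (s p)" for p
  have conv: "s p \<longlonglongrightarrow> g p" for p
  proof -
    have "convergent (s p)"
      by (rule monoseq_imp_convergent_iff_Bseq[THEN iffD2])
        (auto simp: decseq_imp_monoseq dec s_def miss_bounds intro!: BseqI'[of _ 1])
    then show ?thesis by (simp add: g_def convergent_LIMSEQ_iff)
  qed
  have "g p \<le> 0"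
  proof (rule maximum_principle)
    show "g (0, 0) = 0"
    proof -
      have "s (0, 0) = (\<lambda>_. 0)" by (simp add: s_def fun_eq_iff)
      then show ?thesis using conv[of "(0, 0)"] by (simp add: LIMSEQ_const_iff)
    qed
    show "g q \<le> 1" for q
      using conv[of q] by (rule LIMSEQ_le_const2) (auto simp: s_def miss_le_1)
    fix x y :: int
    assume nz: "(x, y) \<noteq> (0, 0)"
    have "(\<lambda>N. (s (x + 1, y) N + s (x - 1, y) N + s (x, y + 1) N + s (x, y - 1) N) / 4)
        \<longlonglongrightarrow> (g (x + 1, y) + g (x - 1, y) + g (x, y + 1) + g (x, y - 1)) / 4"
      by (intro tendsto_intros conv) simp
    moreover have "(\<lambda>N. (s (x + 1, y) N + s (x - 1, y) N + s (x, y + 1) N + s (x, y - 1) N) / 4)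
        = (\<lambda>N. s (x, y) (Suc N))"
      using nz by (auto simp: s_def)
    ultimately show "g (x, y) \<le> (g (x + 1, y) + g (x - 1, y) + g (x, y + 1) + g (x, y - 1)) / 4"
      using LIMSEQ_unique[OF LIMSEQ_Suc[OF conv[of "(x, y)"]]] by simp
  qed
  moreover have "0 \<le> g p"
    using conv[of p] by (rule LIMSEQ_le_const) (auto simp: s_def miss_nonneg)
  ultimately have "s p \<longlonglongrightarrow> 0" using conv[of p] by simp
  moreover have "s p = (\<lambda>N. miss (0, 0) (replicate N 1) p)" by (rule ext) (simp only: s_def)
  ultimately show ?thesis by simp
qed

text \<open>Scaling reduces each start in the residue class of the target to the simple random walk;
  the square is finite, so one \<open>N\<close> serves all of them.\<close>

lemma hitting_word_same_residue:
  assumes "0 < b"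
  obtains N where "\<And>x y. (x, y) \<in> square R \<Longrightarrow> int b dvd x - u \<Longrightarrow> int b dvd y - v \<Longrightarrow>
    miss (u, v) (replicate N b) (x, y) \<le> 1 / 2"
proof -
  define A where "A = {(x, y) \<in> square R. int b dvd x - u \<and> int b dvd y - v}"
  have "finite A" using finite_square[of R] by (rule finite_subset[rotated]) (auto simp: A_def)
  moreover have "\<forall>\<^sub>F N in sequentially. miss (u, v) (replicate N b) p \<le> 1 / 2" if "p \<in> A" for p
  proof -
    obtain i j where "fst p - u = int b * i" "snd p - v = int b * j"
      using \<open>p \<in> A\<close> unfolding A_def dvd_def by fastforce
    then have p: "p = (u + int b * i, v + int b * j)" by (simp add: prod_eq_iff)
    have "\<forall>\<^sub>F N in sequentially. miss (0, 0) (replicate N 1) (i, j) < 1 / 2"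
      by (rule order_tendstoD(2)[OF miss_replicate_1_tendsto_0]) simp
    then show ?thesis
      by eventually_elim (simp only: p miss_replicate_scale[OF assms])
  qed
  ultimately have "\<forall>\<^sub>F N in sequentially. \<forall>p\<in>A. miss (u, v) (replicate N b) p \<le> 1 / 2"
    by (intro eventually_ball_finite) auto
  then obtain N where "\<forall>p\<in>A. miss (u, v) (replicate N b) p \<le> 1 / 2"
    by (auto simp: eventually_sequentially)
  then show ?thesis by (intro that[of N]) (auto simp: A_def)
qed

subsection \<open>Hitting a point with two coprime step lengths\<close>

text \<open>One \<open>c\<close>-step changes the residue modulo \<open>b\<close>, and the long runs of \<open>b\<close>-steps in between hit
  \<open>(u, v)\<close> as soon as the residue is right. Testing after every single \<open>c\<close>-step avoids
  parity obstructions.\<close>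

lemma hitting_word_near_residue:
  assumes "0 < b"
  shows "\<exists>w. set w \<subseteq> {b, c} \<and> (\<forall>x y i j. (x, y) \<in> square R \<longrightarrow> i + j \<le> m \<longrightarrow>
    int b dvd x + int c * int i - u \<longrightarrow> int b dvd y + int c * int j - v \<longrightarrow>
    miss (u, v) w (x, y) \<le> 1 - (1 / 4) ^ m / 2)"
proof (induction m arbitrary: R)
  case 0
  obtain N where "\<And>x y. (x, y) \<in> square R \<Longrightarrow> int b dvd x - u \<Longrightarrow> int b dvd y - v \<Longrightarrow>
    miss (u, v) (replicate N b) (x, y) \<le> 1 / 2"
    using hitting_word_same_residue[OF assms, of R u v] by blast
  then show ?case by (intro exI[of _ "replicate N b"]) auto
next
  case (Suc m)
  define \<delta> :: real where "\<delta> = (1 / 4) ^ m / 2"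
  have \<delta>: "0 < \<delta>" "\<delta> \<le> 1 / 2" by (auto simp: \<delta>_def power_le_one)
  obtain N where N: "\<And>x y. (x, y) \<in> square R \<Longrightarrow> int b dvd x - u \<Longrightarrow> int b dvd y - v \<Longrightarrow>
    miss (u, v) (replicate N b) (x, y) \<le> 1 / 2"
    using hitting_word_same_residue[OF assms, of R u v] by blast
  \<comment> \<open>This larger square contains every point reachable by the run of
    \<open>b\<close>-steps and one \<open>c\<close>-step.\<close>
  obtain w where w: "set w \<subseteq> {b, c}" and hit: "\<And>x y i j. (x, y) \<in> square (R + N * b + c) \<Longrightarrow>
      i + j \<le> m \<Longrightarrow> int b dvd x + int c * int i - u \<Longrightarrow> int b dvd y + int c * int j - v \<Longrightarrow>
      miss (u, v) w (x, y) \<le> 1 - \<delta>"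
    using Suc[of "R + N * b + c"] unfolding \<delta>_def by blast
  have "miss (u, v) (replicate N b @ c # w) (x, y) \<le> 1 - \<delta> / 4"
    if start: "(x, y) \<in> square R" and ij: "i + j \<le> Suc m"
      and dvd: "int b dvd x + int c * int i - u" "int b dvd y + int c * int j - v" for x y i j
  proof (cases "i + j = 0")
    case True
    then have "miss (u, v) (replicate N b) (x, y) \<le> 1 / 2"
      using N[OF start] dvd by simp
    then show ?thesis
      using miss_append_le_left[of "(u, v)" "replicate N b" "c # w" "(x, y)"] \<delta> by linarith
  next
    case False
    have "miss (u, v) (c # w) q \<le> 1 - \<delta> / 4" if q: "q \<in> ends (replicate N b) (x, y)" for q
    proof (cases "q = (u, v)")
      case False
      obtain x' y' where q': "q = (x', y')" by (cases q)
      have sq': "(x', y') \<in> square (R + N * b)"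
        using ends_square[OF start q] by (simp add: q' sum_list_replicate)
      have b: "int b dvd x' - x" "int b dvd y' - y"
        using ends_replicate_dvd[OF q] by (auto simp: q')
      have dvd': "int b dvd x' + int c * int i - u" "int b dvd y' + int c * int j - v"
        using dvd_add[OF b(1) dvd(1)] dvd_add[OF b(2) dvd(2)] by (simp_all add: algebra_simps)
      \<comment> \<open>A \<open>c\<close>-step to the right if \<open>i\<close> is positive, and up
        otherwise, lowers \<open>i + j\<close> by one. It has probability 1/4, and the other
        directions are bounded by 1; hence the loss \<open>\<delta> / 4\<close>.\<close>
      have "miss (u, v) w (x' + int c, y') \<le> 1 - \<delta> \<or> miss (u, v) w (x', y' + int c) \<le> 1 - \<delta>"
      proof (cases i)
        case (Suc i')
        then have "miss (u, v) w (x' + int c, y') \<le> 1 - \<delta>"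
          using sq' ij dvd' by (intro hit[of _ _ i' j]) (auto simp: square_def algebra_simps)
        then show ?thesis ..
      next
        case 0
        then obtain j' where "j = Suc j'" using \<open>i + j \<noteq> 0\<close> by (cases j) auto
        then have "miss (u, v) w (x', y' + int c) \<le> 1 - \<delta>"
          using sq' ij dvd' 0 by (intro hit[of _ _ 0 j']) (auto simp: square_def algebra_simps)
        then show ?thesis ..
      qed
      then show ?thesis
        using False miss_le_1[of "(u, v)" w "(x' + int c, y')"] miss_le_1[of "(u, v)" w "(x' - int c, y')"]
          miss_le_1[of "(u, v)" w "(x', y' + int c)"] miss_le_1[of "(u, v)" w "(x', y' - int c)"]
        by (auto simp: q')
    qed (use \<delta> in auto)
    then have "miss (u, v) (replicate N b @ c # w) (x, y)
        \<le> (1 - \<delta> / 4) * miss (u, v) (replicate N b) (x, y)"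
      using \<delta> by (intro miss_append_le) auto
    also have "\<dots> \<le> (1 - \<delta> / 4) * 1"
      using \<delta> miss_le_1 by (intro mult_left_mono) auto
    finally show ?thesis by simp
  qed
  then show ?case
    using w by (intro exI[of _ "replicate N b @ c # w"]) (auto simp: \<delta>_def)
qed

text \<open>Since \<open>c\<close> is invertible modulo \<open>b\<close>, with Bezout inverse
  \<open>d\<close>, the residue of \<open>d * (u - x)\<close> serves as \<open>i\<close>.\<close>

lemma residue_reachable:
  assumes "coprime b c" "0 < b"
  obtains i :: nat where "i < b" "int b dvd x + int c * int i - u"
proof -
  obtain d e where d: "d * int c + e * int b = 1"
    using bezout_int[of "int c" "int b"] assms(1) by (auto simp: coprime_commute)
  define i where "i = nat ((d * (u - x)) mod int b)"
  define q where "q = (d * (u - x)) div int b"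
  have i: "int i = (d * (u - x)) mod int b" using assms(2) by (simp add: i_def)
  then have i': "int i = d * (u - x) - int b * q"
    by (simp add: q_def minus_mult_div_eq_mod)
  have "x + int c * int i - u
      = (u - x) * (d * int c + e * int b - 1) - int b * (e * (u - x) + int c * q)"
    unfolding i' by (simp add: algebra_simps)
  then have "int b dvd x + int c * int i - u" by (simp add: d)
  moreover have "int i < int b" using assms(2) by (simp add: i)
  ultimately show ?thesis using that by simp
qed

text \<open>The hitting probability \<open>\<epsilon>\<close> does not depend on the square. Words
  can therefore be chained, each built for the square that the previous ones can reach, and each
  multiplies the bound by \<open>1 - \<epsilon>\<close>.\<close>

lemma hitting_word:
  assumes "coprime b c" "0 < b"
  obtains w where "set w \<subseteq> {b, c}" "\<And>p. p \<in> square R \<Longrightarrow> miss z w p \<le> 1 / 2"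
proof -
  \<comment> \<open>Each coordinate needs fewer than \<open>b\<close> steps of length
    \<open>c\<close>, hence the exponent \<open>2 * b\<close>.\<close>
  define \<epsilon> :: real where "\<epsilon> = (1 / 4) ^ (2 * b) / 2"
  have \<epsilon>: "0 < \<epsilon>" "\<epsilon> < 1"
    using power_le_one[of "1 / 4 :: real" "2 * b"] by (auto simp: \<epsilon>_def)
  obtain u v where z: "z = (u, v)" by (cases z)
  have single: "\<exists>w. set w \<subseteq> {b, c} \<and> (\<forall>p\<in>square R. miss z w p \<le> 1 - \<epsilon>)" for R
  proof -
    obtain w where w: "set w \<subseteq> {b, c}" and hit: "\<And>x y i j. (x, y) \<in> square R \<Longrightarrow>
      i + j \<le> 2 * b \<Longrightarrow> int b dvd x + int c * int i - u \<Longrightarrow> int b dvd y + int c * int j - v \<Longrightarrow>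
      miss (u, v) w (x, y) \<le> 1 - \<epsilon>"
      using hitting_word_near_residue[OF assms(2), of c R "2 * b" u v] unfolding \<epsilon>_def by blast
    have "miss z w (x, y) \<le> 1 - \<epsilon>" if "(x, y) \<in> square R" for x y
    proof -
      obtain i where "i < b" "int b dvd x + int c * int i - u"
        by (rule residue_reachable[OF assms])
      moreover obtain j where "j < b" "int b dvd y + int c * int j - v"
        by (rule residue_reachable[OF assms])
      ultimately show ?thesis unfolding z using that by (intro hit[of x y i j]) auto
    qed
    then show ?thesis using w by auto
  qed
  have power: "\<exists>w. set w \<subseteq> {b, c} \<and> (\<forall>p\<in>square R. miss z w p \<le> (1 - \<epsilon>) ^ K)" for K
  proof (induction K)
    case 0
    then show ?case using miss_le_1 by (auto intro: exI[of _ "[]"])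
  next
    case (Suc K)
    then obtain u where u: "set u \<subseteq> {b, c}" "\<And>p. p \<in> square R \<Longrightarrow> miss z u p \<le> (1 - \<epsilon>) ^ K"
      by blast
    obtain v where v: "set v \<subseteq> {b, c}" "\<And>p. p \<in> square (R + sum_list u) \<Longrightarrow> miss z v p \<le> 1 - \<epsilon>"
      using single by blast
    have "miss z (u @ v) p \<le> (1 - \<epsilon>) ^ Suc K" if p: "p \<in> square R" for p
    proof -
      have "miss z (u @ v) p \<le> (1 - \<epsilon>) * miss z u p"
        using \<epsilon> p v(2) ends_square by (intro miss_append_le) auto
      also have "\<dots> \<le> (1 - \<epsilon>) * (1 - \<epsilon>) ^ K"
        using \<epsilon> p u(2) by (intro mult_left_mono) auto
      finally show ?thesis by simp
    qed
    then show ?case using u(1) v(1) by (intro exI[of _ "u @ v"]) auto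
  qed
  obtain K where "(1 - \<epsilon>) ^ K < 1 / 2"
    using real_arch_pow_inv[of "1 / 2" "1 - \<epsilon>"] \<epsilon> by auto
  then show ?thesis using power[of K] that by (meson less_imp_le order_trans)
qed

subsection \<open>The law of the walk\<close>

definition int_pair :: "int \<times> int \<Rightarrow> real \<times> real" where
  "int_pair z = (real_of_int (fst z), real_of_int (snd z))"

abbreviation walk :: "(nat \<Rightarrow> nat) \<Rightarrow> nat \<Rightarrow> (nat \<Rightarrow> real \<times> real) \<Rightarrow> real \<times> real" where
  "walk a \<equiv> rademacher2_walk (\<lambda>i. real (a i)) (\<lambda>i \<omega>. \<omega> i)"

lemma walk_case_nat:
  "walk a (Suc n) (case_nat e \<omega>) = real (a 0) *\<^sub>R e + walk (\<lambda>i. a (Suc i)) n \<omega>"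
  unfolding rademacher2_walk_def by (subst sum.lessThan_Suc_shift) simp

lemma walk_0 [simp]: "walk a 0 \<omega> = 0"
  by (simp add: rademacher2_walk_def)

lemma space_rademacher2_space [simp]: "space rademacher2_space = UNIV"
  by (simp add: rademacher2_space_def space_PiM)

lemma sets_rademacher2_space [measurable_cong]:
  "sets rademacher2_space = sets (PiM UNIV (\<lambda>_. borel))"
  unfolding rademacher2_space_def by (intro sets_PiM_cong) simp_all

lemma walk_measurable [measurable]: "walk a n \<in> borel_measurable rademacher2_space"
  unfolding rademacher2_walk_def by measurable

text \<open>Conditioning on the first vector: prepending an independent copy of it preserves the
  product measure, and Fubini leaves an average over its four values.\<close>

lemma emeasure_rademacher2_space_step:
  assumes A: "A \<in> sets rademacher2_space"
  shows "emeasure rademacher2_space A =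
    (\<Sum>e\<in>{(1, 0), (0, 1), (-1, 0), (0, -1)}. emeasure rademacher2_space {\<omega>. case_nat e \<omega> \<in> A}) / 4"
proof -
  interpret R: sequence_space rademacher2
    by (simp add: sequence_space_def product_prob_spaceI prob_space_rademacher2)
  interpret P: prob_space rademacher2_space
    unfolding rademacher2_space_def by (intro prob_space_PiM prob_space_rademacher2)
  let ?f = "\<lambda>(s, \<omega>). case_nat s \<omega> :: nat \<Rightarrow> real \<times> real"
  let ?X = "?f -` A \<inter> space (rademacher2 \<Otimes>\<^sub>M rademacher2_space)"
  have f [measurable]: "?f \<in> measurable (rademacher2 \<Otimes>\<^sub>M rademacher2_space) rademacher2_space"
    unfolding rademacher2_space_def by measurable
  have X [measurable]: "?X \<in> sets (rademacher2 \<Otimes>\<^sub>M rademacher2_space)"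
    using A by measurable
  have "emeasure rademacher2_space A
      = emeasure (distr (rademacher2 \<Otimes>\<^sub>M rademacher2_space) rademacher2_space ?f) A"
    using R.PiM_iter by (simp add: rademacher2_space_def)
  also have "\<dots> = emeasure (rademacher2 \<Otimes>\<^sub>M rademacher2_space) ?X"
    by (rule emeasure_distr[OF f A])
  also have "\<dots> = (\<integral>\<^sup>+ e. emeasure rademacher2_space (Pair e -` ?X) \<partial>rademacher2)"
    by (rule P.emeasure_pair_measure_alt[OF X])
  also have "\<dots> = (\<integral>\<^sup>+ e. emeasure rademacher2_space (Pair e -` ?X)
      \<partial>measure_pmf (pmf_of_set {(1, 0), (0, 1), (-1, 0), (0, -1)}))"
  proof -
    have "(\<lambda>e. emeasure rademacher2_space (Pair e -` ?X)) \<in> borel_measurable rademacher2"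
      by (rule P.measurable_emeasure_Pair[OF X])
    then have "(\<lambda>e. emeasure rademacher2_space (Pair e -` ?X)) \<in> borel_measurable borel"
      by (simp cong: measurable_cong_sets)
    then show ?thesis
      unfolding rademacher2_def by (subst nn_integral_distr) (simp_all flip: rademacher2_def)
  qed
  also have "\<dots> = (\<Sum>e\<in>{(1, 0), (0, 1), (-1, 0), (0, -1)}.
      emeasure rademacher2_space (Pair e -` ?X)) / 4"
    by (subst nn_integral_pmf_of_set) simp_all
  also have "(\<lambda>e. Pair e -` ?X) = (\<lambda>e. {\<omega>. case_nat e \<omega> \<in> A})"
    by (auto simp: space_pair_measure fun_eq_iff)
  finally show ?thesis .
qed

text \<open>Both sides obey the same first-step recursion, in which the start moves and the
  coefficients shift; hence the induction with \<open>a\<close> and \<open>p\<close>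
  arbitrary.\<close>

lemma rademacher2_space_miss:
  "emeasure rademacher2_space {\<omega>. \<forall>j\<le>n. int_pair p + walk a j \<omega> \<noteq> int_pair z}
    = ennreal (miss z (map a [0..<n]) p)"
proof (induction n arbitrary: a p)
  case 0
  interpret P: prob_space rademacher2_space
    unfolding rademacher2_space_def by (intro prob_space_PiM prob_space_rademacher2)
  have "int_pair p = int_pair z \<longleftrightarrow> p = z" by (auto simp: int_pair_def prod_eq_iff)
  then show ?case using P.emeasure_space_1 by auto
next
  case (Suc n)
  obtain x y where p: "p = (x, y)" by (cases p)
  define A where "A = {\<omega>. \<forall>j\<le>Suc n. int_pair p + walk a j \<omega> \<noteq> int_pair z}"
  have inj: "int_pair p = int_pair z \<longleftrightarrow> p = z" by (auto simp: int_pair_def prod_eq_iff)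
  show ?case
  proof (cases "p = z")
    case True
    then have "A = {}" by (auto simp: A_def intro!: exI[of _ 0])
    then show ?thesis unfolding A_def[symmetric] by (simp add: True)
  next
    case False
    let ?a = "\<lambda>i. a (Suc i)"
    have "{\<omega> \<in> space rademacher2_space. \<forall>j\<le>Suc n. int_pair p + walk a j \<omega> \<noteq> int_pair z}
        \<in> sets rademacher2_space" by measurable
    then have A: "A \<in> sets rademacher2_space" by (simp add: A_def)
    have step: "{\<omega>. case_nat (real_of_int u, real_of_int v) \<omega> \<in> A} =
        {\<omega>. \<forall>j\<le>n. int_pair (x + a 0 * u, y + a 0 * v) + walk ?a j \<omega> \<noteq> int_pair z}" for u v :: int
    proof -
      have "(\<forall>j\<le>Suc n. Q j) \<longleftrightarrow> Q 0 \<and> (\<forall>j\<le>n. Q (Suc j))" for Q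
        using All_less_Suc2[of "Suc n"] by (simp add: less_Suc_eq_le)
      then show ?thesis
        using False inj
        by (simp add: A_def walk_case_nat p int_pair_def plus_prod_def algebra_simps)
    qed
    have "map a [0..<Suc n] = a 0 # map ?a [0..<n]"
      by (simp add: upt_conv_Cons map_Suc_upt[symmetric] del: upt_Suc)
    then have m: "miss z (map a [0..<Suc n]) p =
      (miss z (map ?a [0..<n]) (x + a 0, y) + miss z (map ?a [0..<n]) (x - a 0, y)
         + miss z (map ?a [0..<n]) (x, y + a 0) + miss z (map ?a [0..<n]) (x, y - a 0)) / 4"
      using False by (simp add: p)
    show ?thesis
      using step[of 1 0] step[of 0 1] step[of "-1" 0] step[of 0 "-1"]
      unfolding A_def[symmetric] emeasure_rademacher2_space_step[OF A] m
      by (simp add: Suc.IH miss_nonneg divide_ennreal add_ac flip: ennreal_plus ennreal_numeral)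
  qed
qed

lemma AE_rademacher2_space_stepI:
  assumes [measurable]: "Measurable.pred rademacher2_space Q"
    and Q: "\<And>u v :: int. AE \<omega> in rademacher2_space. Q (case_nat (real_of_int u, real_of_int v) \<omega>)"
  shows "AE \<omega> in rademacher2_space. Q \<omega>"
proof -
  have "{\<omega> \<in> space rademacher2_space. \<not> Q \<omega>} \<in> sets rademacher2_space" by measurable
  then have A: "{\<omega>. \<not> Q \<omega>} \<in> sets rademacher2_space" by simp
  have "emeasure rademacher2_space {\<omega>. case_nat (real_of_int u, real_of_int v) \<omega> \<in> {\<omega>. \<not> Q \<omega>}} = 0"
    for u v :: int
  proof -
    have "(\<lambda>\<omega>. case_nat (real_of_int u, real_of_int v) \<omega>) \<in> measurable rademacher2_space rademacher2_space"
      unfolding rademacher2_space_def by measurable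
    then have [measurable]: "Measurable.pred rademacher2_space
        (\<lambda>\<omega>. Q (case_nat (real_of_int u, real_of_int v) \<omega>))"
      by measurable
    have "{\<omega> \<in> space rademacher2_space. \<not> Q (case_nat (real_of_int u, real_of_int v) \<omega>)}
        \<in> sets rademacher2_space" by measurable
    from AE_iff_measurable[OF this, where P = "\<lambda>\<omega>. Q (case_nat (real_of_int u, real_of_int v) \<omega>)"]
    show ?thesis using Q[of u v] by simp
  qed
  from this[of 1 0] this[of 0 1] this[of "-1" 0] this[of 0 "-1"]
  have "emeasure rademacher2_space {\<omega>. \<not> Q \<omega>} = 0"
    by (simp add: emeasure_rademacher2_space_step[OF A])
  then show ?thesis using A by (intro AE_I[of _ _ "{\<omega>. \<not> Q \<omega>}"]) auto
qed

text \<open>It suffices to hit the target almost surely after each time \<open>m\<close>.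
  Conditioning on the first \<open>m\<close> steps one at a time moves them into the start
  \<open>p\<close>; for \<open>m = 0\<close>, the probability of no hit is below every power of
  1/2.\<close>

lemma rademacher2_recurrent_if_miss_small:
  assumes "\<And>m p z j. \<exists>n. miss z (map a [m..<m + n]) p \<le> (1 / 2) ^ j"
  shows "rademacher2_recurrent (\<lambda>i. real (a i))"
proof -
  interpret P: prob_space rademacher2_space
    unfolding rademacher2_space_def by (intro prob_space_PiM prob_space_rademacher2)
  have late_hit: "AE \<omega> in rademacher2_space. \<exists>j\<ge>m. int_pair p + walk a j \<omega> = int_pair z"
    if "\<And>m p z j. \<exists>n. miss z (map a [m..<m + n]) p \<le> (1 / 2) ^ j" for m p z a
    using that
  proof (induction m arbitrary: a p)
    case 0
    define A where "A = {\<omega>. \<forall>j. int_pair p + walk a j \<omega> \<noteq> int_pair z}"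
    have "{\<omega> \<in> space rademacher2_space. \<forall>j. int_pair p + walk a j \<omega> \<noteq> int_pair z}
        \<in> sets rademacher2_space" by measurable
    then have A: "A \<in> sets rademacher2_space" by (simp add: A_def)
    have "measure rademacher2_space A \<le> (1 / 2) ^ j" for j
    proof -
      obtain n where n: "miss z (map a [0..<n]) p \<le> (1 / 2) ^ j"
        using 0[of z 0 p j] by auto
      let ?C = "{\<omega>. \<forall>j\<le>n. int_pair p + walk a j \<omega> \<noteq> int_pair z}"
      have "{\<omega> \<in> space rademacher2_space. \<forall>j\<le>n. int_pair p + walk a j \<omega> \<noteq> int_pair z}
        \<in> sets rademacher2_space" by measurable
      then have "measure rademacher2_space A \<le> measure rademacher2_space ?C"
        by (intro P.finite_measure_mono) (auto simp: A_def)
      also have "\<dots> = miss z (map a [0..<n]) p"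
        by (simp add: measure_def rademacher2_space_miss miss_nonneg)
      finally show ?thesis using n by simp
    qed
    moreover have "(\<lambda>j. (1 / 2 :: real) ^ j) \<longlonglongrightarrow> 0" by (intro LIMSEQ_realpow_zero) auto
    ultimately have "measure rademacher2_space A \<le> 0"
      by (intro LIMSEQ_le_const[where X = "\<lambda>j. (1 / 2) ^ j"]) auto
    then have "emeasure rademacher2_space A = 0"
      by (simp add: P.emeasure_eq_measure measure_le_0_iff)
    then show ?case using A by (intro AE_I[of _ _ A]) (auto simp: A_def)
  next
    case (Suc m)
    show ?case
    proof (rule AE_rademacher2_space_stepI)
      fix u v :: int
      have "\<exists>n. miss z (map (\<lambda>i. a (Suc i)) [m'..<m' + n]) p' \<le> (1 / 2) ^ j" for m' p' z j
        using Suc.prems[of z "Suc m'" p' j] by (simp add: map_Suc_upt[symmetric] comp_def del: upt_Suc)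
      then have "AE \<omega> in rademacher2_space. \<exists>j\<ge>m.
          int_pair (fst p + a 0 * u, snd p + a 0 * v) + walk (\<lambda>i. a (Suc i)) j \<omega> = int_pair z"
        by (rule Suc.IH)
      then show "AE \<omega> in rademacher2_space. \<exists>j\<ge>Suc m.
          int_pair p + walk a j (case_nat (real_of_int u, real_of_int v) \<omega>) = int_pair z"
      proof eventually_elim
        case (elim \<omega>)
        then obtain j where "j \<ge> m"
          "int_pair (fst p + a 0 * u, snd p + a 0 * v) + walk (\<lambda>i. a (Suc i)) j \<omega> = int_pair z"
          by blast
        then show ?case
          by (intro exI[of _ "Suc j"])
            (simp add: walk_case_nat int_pair_def plus_prod_def algebra_simps)
      qed
    qed measurable
  qed
  have "AE \<omega> in rademacher2_space. infinite {n. walk a n \<omega> = (of_int x, of_int y)}" for x y :: int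
  proof -
    have "AE \<omega> in rademacher2_space. \<forall>m. \<exists>j\<ge>m. walk a j \<omega> = (of_int x, of_int y)"
      using late_hit[OF assms, of _ "(0, 0)" "(x, y)"]
      by (simp add: AE_all_countable int_pair_def flip: zero_prod_def)
    then show ?thesis by eventually_elim (simp add: infinite_nat_iff_unbounded_le)
  qed
  then show ?thesis by (simp add: rademacher2_recurrent_def recurrent_def)
qed

subsection \<open>The sequence of coefficients\<close>

theorem theorem3:
  fixes B :: "nat set"
  assumes "B \<noteq> {}" and "\<forall>b\<in>B. 0 < b" and "good B"
  shows "\<exists>a :: nat \<Rightarrow> nat.
           range a = B \<and>
           (\<forall>b\<in>B. finite {i. a i = b}) \<and>
           rademacher2_recurrent (\<lambda>i. real (a i))"
proof -
  have inf: "infinite B"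
  proof -
    obtain b where "b \<in> B" using assms(1) by blast
    then have "infinite {c \<in> B. coprime b c}" using assms(3) by (simp add: good_def)
    then show ?thesis by (rule contrapos_nn) simp
  qed
  \<comment> \<open>The increasing enumeration gives \<open>k \<le> \<beta> k\<close>, so small
    elements cannot recur in late words.\<close>
  define \<beta> where "\<beta> = enumerate B"
  have \<beta>: "\<beta> k \<in> B" "k \<le> \<beta> k" "range \<beta> = B" for k
    using inf by (simp_all add: \<beta>_def enumerate_in_set le_enumerate range_enumerate)
  have "\<exists>c\<in>B. coprime (\<beta> k) c \<and> k \<le> c" for k
    using assms(3) \<beta>(1)[of k] by (auto simp: good_def infinite_nat_iff_unbounded_le)
  then obtain \<gamma> where \<gamma>: "\<And>k. \<gamma> k \<in> B" "\<And>k. coprime (\<beta> k) (\<gamma> k)" "\<And>k. k \<le> \<gamma> k"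
    by metis
  \<comment> \<open>The second component of the pair is ignored, so every target recurs infinitely
    often.\<close>
  define \<zeta> :: "nat \<Rightarrow> int \<times> int" where "\<zeta> k = from_nat (fst (prod_decode k))" for k
  have \<zeta>: "\<exists>k\<ge>K. \<zeta> k = z" for K z
    by (intro exI[of _ "prod_encode (to_nat z, K)"]) (simp add: \<zeta>_def le_prod_encode_2)
  \<comment> \<open>The leading \<open>\<beta> k\<close> ensures that every element of
    \<open>B\<close> occurs, whatever \<open>w\<close> is. The radius allows for a start in
    \<open>square k\<close> followed by all earlier steps and this one.\<close>
  define ext where "ext k u v \<longleftrightarrow> (\<exists>w. v = u @ \<beta> k # w \<and> set w \<subseteq> {\<beta> k, \<gamma> k} \<and>
      (\<forall>p\<in>square (k + sum_list u + \<beta> k). miss (\<zeta> k) w p \<le> 1 / 2))" for k u v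
  have "\<exists>v. ext k u v" for k u
  proof -
    have "0 < \<beta> k" using assms(2) \<beta>(1) by blast
    then obtain w where "set w \<subseteq> {\<beta> k, \<gamma> k}"
      "\<And>p. p \<in> square (k + sum_list u + \<beta> k) \<Longrightarrow> miss (\<zeta> k) w p \<le> 1 / 2"
      using hitting_word[OF \<gamma>(2)] by blast
    then show ?thesis by (auto simp: ext_def)
  qed
  then have "\<exists>P. (\<forall>k. k = 0 \<longrightarrow> P k = []) \<and> (\<forall>k. ext k (P k) (P (Suc k)))"
    using dependent_nat_choice[of "\<lambda>k u. k = 0 \<longrightarrow> u = []" ext] by auto
  then obtain P where P0: "P 0 = []" and P: "\<And>k. ext k (P k) (P (Suc k))" by blast

  have prefix: "\<exists>v. P K' = P K @ v \<and> set v \<subseteq> B \<inter> {K..}" if "K \<le> K'" for K K'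
    using that
  proof (induction K' rule: dec_induct)
    case (step K')
    then obtain v where v: "P K' = P K @ v" "set v \<subseteq> B \<inter> {K..}" by blast
    obtain w where w: "P (Suc K') = P K' @ \<beta> K' # w" "set w \<subseteq> {\<beta> K', \<gamma> K'}"
      using P[of K'] by (auto simp: ext_def)
    have "{\<beta> K', \<gamma> K'} \<subseteq> B \<inter> {K..}"
      using \<beta>(1,2)[of K'] \<gamma>(1,3)[of K'] step.hyps by auto
    then show ?case using v w by (intro exI[of _ "v @ \<beta> K' # w"]) auto
  qed simp
  have len: "k \<le> length (P k)" for k
  proof (induction k)
    case (Suc k)
    then show ?case using P[of k] by (auto simp: ext_def)
  qed simp
  \<comment> \<open>By \<open>len\<close>, the prefix \<open>P (Suc i)\<close> is long enough to
    have an entry at \<open>i\<close>.\<close>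
  define a where "a i = P (Suc i) ! i" for i
  have a: "a i = P K ! i" if "i < length (P K)" for i K
  proof (cases "K \<le> Suc i")
    case True
    then show ?thesis using prefix[OF True] that by (auto simp: a_def nth_append)
  next
    case False
    then have "Suc i \<le> K" by simp
    then show ?thesis
      using prefix[of "Suc i" K] len[of "Suc i"] by (auto simp: a_def nth_append)
  qed
  show ?thesis
  proof (intro exI[of _ a] conjI ballI)
    show "rademacher2_recurrent (\<lambda>i. real (a i))"
    proof (rule rademacher2_recurrent_if_miss_small)
      fix m p z j
      \<comment> \<open>From stage \<open>k0\<close> on, the prefix has length at least
        \<open>m\<close> and \<open>square k\<close> contains \<open>p\<close>.\<close>
      define k0 where "k0 = max m (nat (max \<bar>fst p\<bar> \<bar>snd p\<bar>))"
      have p: "p \<in> square k" if "k0 \<le> k" for k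
        using that by (cases p) (auto simp: k0_def square_def)
      have "\<exists>K\<ge>k0. miss z (drop m (P K)) p \<le> (1 / 2) ^ j"
      proof (induction j)
        case 0
        then show ?case using miss_le_1 by auto
      next
        case (Suc j)
        then obtain K where K: "k0 \<le> K" "miss z (drop m (P K)) p \<le> (1 / 2) ^ j" by blast
        obtain k where k: "K \<le> k" "\<zeta> k = z" using \<zeta> by blast
        have m: "m \<le> length (P K)" "m \<le> length (P k)"
          using len[of K] len[of k] K(1) k(1) by (auto simp: k0_def)
        obtain v where "P k = P K @ v" using prefix[OF k(1)] by blast
        then have "miss z (drop m (P k)) p \<le> miss z (drop m (P K)) p"
          using m by (simp add: miss_append_le_left)
        with K(2) have le: "miss z (drop m (P k)) p \<le> (1 / 2) ^ j" by simp
        \<comment> \<open>Each later stage with target \<open>z\<close> halves the probability of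
          missing \<open>z\<close>, wherever the earlier steps have led.\<close>
        obtain w where w: "P (Suc k) = P k @ \<beta> k # w"
          "\<And>q. q \<in> square (k + sum_list (P k) + \<beta> k) \<Longrightarrow> miss z w q \<le> 1 / 2"
          using P[of k] k(2) by (auto simp: ext_def)
        have drop_le: "sum_list (drop m (P k)) \<le> sum_list (P k)"
          by (metis append_take_drop_id le_add2 sum_list_append)
        have half: "miss z w q \<le> 1 / 2" if "q \<in> ends (drop m (P k) @ [\<beta> k]) p" for q
        proof -
          have "q \<in> square (k + sum_list (drop m (P k) @ [\<beta> k]))"
            using ends_square[OF p that] K(1) k(1) by simp
          then have "q \<in> square (k + sum_list (P k) + \<beta> k)"
            using square_mono[of "k + sum_list (drop m (P k) @ [\<beta> k])"
                "k + sum_list (P k) + \<beta> k"] drop_le by auto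
          then show ?thesis by (rule w(2))
        qed
        have "miss z (drop m (P (Suc k))) p = miss z ((drop m (P k) @ [\<beta> k]) @ w) p"
          using m by (simp add: w(1))
        also have "\<dots> \<le> 1 / 2 * miss z (drop m (P k) @ [\<beta> k]) p"
          using half by (intro miss_append_le) auto
        also have "\<dots> \<le> 1 / 2 * miss z (drop m (P k)) p"
          by (simp add: miss_append_le_left)
        also have "\<dots> \<le> (1 / 2) ^ Suc j" using le by simp
        finally show ?case using K(1) k(1) by (intro exI[of _ "Suc k"]) auto
      qed
      then obtain K where K: "k0 \<le> K" "miss z (drop m (P K)) p \<le> (1 / 2) ^ j" by blast
      have "m \<le> length (P K)" using len[of K] K(1) by (auto simp: k0_def)
      moreover from this have "map a [m..<length (P K)] = drop m (P K)"
        by (intro nth_equalityI) (auto simp: a)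
      ultimately show "\<exists>n. miss z (map a [m..<m + n]) p \<le> (1 / 2) ^ j"
        using K(2) by (intro exI[of _ "length (P K) - m"]) simp
    qed
    have late: "a i \<in> B \<and> k \<le> a i" if "length (P k) \<le> i" for i k
    proof -
      define K where "K = max k (Suc i)"
      have i: "i < length (P K)" using len[of K] by (simp add: K_def)
      obtain v where v: "P K = P k @ v" "set v \<subseteq> B \<inter> {k..}"
        using prefix[of k K] by (auto simp: K_def)
      have "a i = v ! (i - length (P k))"
        using that by (simp add: a[OF i] v(1) nth_append)
      moreover have "i - length (P k) < length v" using i that by (simp add: v(1))
      ultimately show ?thesis using v(2) nth_mem by fastforce
    qed
    show "finite {i. a i = b}" for b
    proof -
      \<comment> \<open>Beyond the prefix \<open>P (Suc b)\<close> all entries are at least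
        \<open>Suc b\<close>.\<close>
      have "{i. a i = b} \<subseteq> {..<length (P (Suc b))}"
        by (auto simp: not_le[symmetric] dest!: late)
      then show ?thesis by (rule finite_subset) simp
    qed
    show "range a = B"
    proof
      show "B \<subseteq> range a"
      proof
        fix b
        assume "b \<in> B"
        then obtain k where k: "b = \<beta> k" using \<beta>(3) by blast
        have "\<beta> k \<in> set (P (Suc k))" using P[of k] by (auto simp: ext_def)
        then obtain i where "i < length (P (Suc k))" "P (Suc k) ! i = b"
          using k by (auto simp: in_set_conv_nth)
        then show "b \<in> range a" using a by (metis rangeI)
      qed
      show "range a \<subseteq> B"
        using late[of 0] by (auto simp: P0)
    qed
  qed
qed

end
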